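(* Let $p$ be any odd prime and let $x$ be a $p$-adic integer. Then $$\sum_{k=0}^{p-1}(-1)^kd_k(x)^2=\sum_{k=0}^{p-1}d_k(x)d_k(-1-x)\equiv(-1)^{\langle x\rangle_p}\pmod{p^2},$$ $$\sum_{k=0}^{p-1}d_k(x)^2=\sum_{k=0}^{p-1}(-1)^kd_k(x)d_k(-1-x)\equiv\begin{cases}\left(\frac{-1}{p}\right)\pmod{p^2}&\text{if } x\equiv-1/2\pmod p,\\ (-1)^{\langle x\rangle_p}\,\dfrac{p+2x-2\langle x\rangle_p}{2x+1}\pmod{p^2}&\text{otherwise},\end{cases}$$ and $$\sum_{k=0}^{p-1}(2k+1)d_k(x)^2\equiv\begin{cases}-x\pmod{p^2}&\text{if } x\equiv0\pmod p,\\ x+1\pmod{p^2}&\text{if } x\equiv-1\pmod p,\\ 0\pmod{p^2}&\text{otherwise}.\end{cases}$$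
   Context: For $n\in\{0,1,2,\ldots\}$, $d_n(x)=\sum_{k=0}^n\binom nk\binom xk2^k$, where $\binom xk=x(x-1)\cdots(x-k+1)/k!$. For a $p$-adic integer $x$, $\langle x\rangle_p$ denotes the least nonnegative integer $r$ with $x\equiv r\pmod p$. For $p$-adic numbers $a,b$, $a\equiv b\pmod{p^m}$ means $(a-b)/p^m$ is a $p$-adic integer. $\left(\frac{\cdot}{p}\right)$ is the Legendre symbol. *)

theory Defs
  imports
    "HOL-Computational_Algebra.Computational_Algebra"
    "HOL-Number_Theory.Number_Theory"
    "Berlekamp_Zassenhaus.Finite_Field"
begin

text \<open>
  The prime \<open>p\<close> is carried by a type \<open>'p\<close> of class \<open>prime_card\<close>, as \<open>p = CARD('p)\<close>.
  The ring of \<open>p\<close>-adic integers is the inverse limit of the rings of integers modulo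
  \<open>p ^ n\<close>: the \<open>n\<close>-th entry is the representative in \<open>{0..<p ^ n}\<close> of the
  residue class modulo \<open>p ^ n\<close>.
\<close>

typedef (overloaded) ('p :: prime_card) padic_int =
  "{f :: nat \<Rightarrow> int. \<forall>n. f n \<in> {0..<int CARD('p) ^ n} \<and> f (Suc n) mod int CARD('p) ^ n = f n}"
  morphisms padic_residue Abs_padic_int
  by (rule exI[of _ "\<lambda>_. 0"]) (simp add: prime_card prime_gt_0_nat)

setup_lifting type_definition_padic_int

lemma mod_power_Suc_mod: "a mod (c :: int) ^ Suc n mod c ^ n = a mod c ^ n"
  by (rule mod_mod_cancel) (simp add: le_imp_power_dvd)

lemma CARD_power_pos: "0 < int CARD('p :: prime_card) ^ n"
  by (simp add: prime_card prime_gt_0_nat)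

lemma padic_closed:
  fixes g :: "nat \<Rightarrow> int"
  assumes "\<And>n. g (Suc n) mod int CARD('p :: prime_card) ^ n = g n mod int CARD('p) ^ n"
  shows "g n mod int CARD('p) ^ n \<in> {0..<int CARD('p) ^ n} \<and>
    g (Suc n) mod int CARD('p) ^ Suc n mod int CARD('p) ^ n = g n mod int CARD('p) ^ n"
  using assms CARD_power_pos[where 'p = 'p] by (simp only: mod_power_Suc_mod) simp

lemma padic_residue_mod:
  "padic_residue x n mod int CARD('p) ^ n = padic_residue (x :: 'p :: prime_card padic_int) n"
  using padic_residue[of x] by simp

lemma padic_residue_Suc_mod:
  "padic_residue x (Suc n) mod int CARD('p) ^ n = padic_residue (x :: 'p :: prime_card padic_int) n"
  using padic_residue[of x] by simp

lemma padic_residue_add_mod: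
  "padic_residue x (n + k) mod int CARD('p) ^ n = padic_residue (x :: 'p :: prime_card padic_int) n"
proof (induction k)
  case 0
  show ?case by (simp add: padic_residue_mod)
next
  case (Suc k)
  have "padic_residue x (n + Suc k) mod int CARD('p) ^ n =
      padic_residue x (Suc (n + k)) mod int CARD('p) ^ (n + k) mod int CARD('p) ^ n"
    by (simp add: mod_mod_cancel le_imp_power_dvd)
  with Suc show ?case by (simp only: padic_residue_Suc_mod)
qed

instantiation padic_int :: (prime_card) comm_ring_1
begin

lift_definition zero_padic_int :: "'a padic_int" is "\<lambda>_. 0"
  by (simp add: CARD_power_pos)

lift_definition one_padic_int :: "'a padic_int" is "\<lambda>n. 1 mod int CARD('a) ^ n"
  by (rule padic_closed) simp

lift_definition plus_padic_int :: "'a padic_int \<Rightarrow> 'a padic_int \<Rightarrow> 'a padic_int"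
  is "\<lambda>f g n. (f n + g n) mod int CARD('a) ^ n"
  by (rule padic_closed) (metis mod_add_eq mod_mod_trivial)

lift_definition minus_padic_int :: "'a padic_int \<Rightarrow> 'a padic_int \<Rightarrow> 'a padic_int"
  is "\<lambda>f g n. (f n - g n) mod int CARD('a) ^ n"
  by (rule padic_closed) (metis mod_diff_eq mod_mod_trivial)

lift_definition uminus_padic_int :: "'a padic_int \<Rightarrow> 'a padic_int"
  is "\<lambda>f n. (- f n) mod int CARD('a) ^ n"
  by (rule padic_closed) (metis mod_minus_eq mod_mod_trivial)

lift_definition times_padic_int :: "'a padic_int \<Rightarrow> 'a padic_int \<Rightarrow> 'a padic_int"
  is "\<lambda>f g n. (f n * g n) mod int CARD('a) ^ n"
  by (rule padic_closed) (metis mod_mult_eq mod_mod_trivial)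

instance
proof
  show "(0 :: 'a padic_int) \<noteq> 1"
  proof
    assume "(0 :: 'a padic_int) = 1"
    then have "padic_residue (0 :: 'a padic_int) 1 = padic_residue (1 :: 'a padic_int) 1"
      by simp
    moreover have "1 < int CARD('a)"
      using prime_card_int prime_gt_1_int by blast
    ultimately show False
      by (simp add: zero_padic_int.rep_eq one_padic_int.rep_eq)
  qed
qed (transfer; simp add: fun_eq_iff mod_simps algebra_simps)+

end

instance padic_int :: (prime_card) idom
proof
  fix x y :: "'a padic_int"
  let ?p = "int CARD('a)"
  assume "x \<noteq> 0" "y \<noteq> 0"
  then obtain m n where m: "padic_residue x m \<noteq> 0" and n: "padic_residue y n \<noteq> 0"
    by (metis ext padic_residue_inject zero_padic_int.rep_eq)
  let ?a = "padic_residue x (m + n)" and ?b = "padic_residue y (m + n)"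
  have a: "\<not> ?p ^ m dvd ?a"
    using m padic_residue_add_mod[of x m n] by (simp add: dvd_eq_mod_eq_0)
  have b: "\<not> ?p ^ n dvd ?b"
    using n padic_residue_add_mod[of y n m] by (simp add: dvd_eq_mod_eq_0 add.commute)
  have p: "prime ?p"
    by (rule prime_card_int)
  have nz: "?a \<noteq> 0" "?b \<noteq> 0"
    using a b by auto
  have "multiplicity ?p ?a < m" "multiplicity ?p ?b < n"
    using a b nz p by (metis multiplicity_dvd' not_le)+
  then have "\<not> ?p ^ (m + n) dvd ?a * ?b"
    using nz p
    by (subst power_dvd_iff_le_multiplicity)
      (auto simp: prime_elem_multiplicity_mult_distrib prime_imp_prime_elem)
  then have "padic_residue (x * y) (m + n) \<noteq> padic_residue 0 (m + n)"
    by (simp add: times_padic_int.rep_eq zero_padic_int.rep_eq dvd_eq_mod_eq_0)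
  then show "x * y \<noteq> 0"
    by metis
qed

lemma padic_residue_of_nat:
  "padic_residue (of_nat k :: 'p :: prime_card padic_int) n = int k mod int CARD('p) ^ n"
  by (induction k) (simp_all add: zero_padic_int.rep_eq one_padic_int.rep_eq plus_padic_int.rep_eq mod_simps)

instance padic_int :: (prime_card) ring_char_0
proof
  show "inj (of_nat :: nat \<Rightarrow> 'a padic_int)"
  proof (rule injI)
    fix i j :: nat
    assume "(of_nat i :: 'a padic_int) = of_nat j"
    then have eq: "int i mod int CARD('a) ^ (i + j) = int j mod int CARD('a) ^ (i + j)"
      by (metis padic_residue_of_nat)
    have "1 < CARD('a)"
      using prime_card prime_gt_1_nat by blast
    then have "i + j < CARD('a) ^ (i + j)"
      by (simp add: power_gt_expt)
    then have "int i + int j < int CARD('a) ^ (i + j)"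
      by (metis of_nat_add of_nat_less_iff of_nat_power)
    then have "int i mod int CARD('a) ^ (i + j) = int i" "int j mod int CARD('a) ^ (i + j) = int j"
      by (intro mod_pos_pos_trivial; linarith)+
    with eq show "i = j"
      by simp
  qed
qed

instance fract :: ("{idom, ring_char_0}") ring_char_0
proof
  show "inj (of_nat :: nat \<Rightarrow> 'a fract)"
    by (rule injI) (simp add: of_nat_fract eq_fract)
qed

instance fract :: ("{idom, ring_char_0}") field_char_0 ..

type_synonym 'p padic = "'p padic_int fract"

definition padic_Ints :: "'p :: prime_card padic set" where
  "padic_Ints = range to_fract"

definition padic_cong :: "'p :: prime_card padic \<Rightarrow> 'p padic \<Rightarrow> nat \<Rightarrow> bool" where
  "padic_cong a b m \<longleftrightarrow> (a - b) / of_nat CARD('p) ^ m \<in> padic_Ints"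

definition padic_least_residue :: "'p :: prime_card padic \<Rightarrow> nat" where
  "padic_least_residue x = (LEAST r. padic_cong x (of_nat r) 1)"

definition dpoly :: "nat \<Rightarrow> 'a :: field_char_0 \<Rightarrow> 'a" where
  "dpoly n x = (\<Sum>k=0..n. of_nat (n choose k) * (x gchoose k) * 2 ^ k)"

end

theory Submission
  imports Defs
begin

text \<open>
  The polynomials satisfy \<open>d (n + 1) (x + 1) - d (n + 1) x = d n (x + 1) + d n x\<close> and
  \<open>(x + 1) (d n (x + 1) - d n x) = n (d n x + d (n - 1) x)\<close>, hence a three-term recurrence and the
  reflection \<open>d n (- 1 - x) = (- 1) ^ n d n x\<close>. These make all three sums telescope: with
  \<open>S n x = d n (x + 1) - d n x\<close>, the alternating sum of squares below \<open>n\<close> at \<open>x\<close> plus that at \<open>x + 1\<close>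
  is \<open>\<plusminus>(S n x)\<^sup>2 / 2\<close>, the plain sum is \<open>n d n x d (n - 1) x / (2 x + 1)\<close>, and four times
  the weighted sum is \<open>(x + 1) (S n x)\<^sup>2 - x (S n (x - 1))\<^sup>2\<close>. For \<open>n = p\<close> the number \<open>S p x\<close> is
  divisible by \<open>p\<close> unless \<open>x \<equiv> - 1\<close> modulo \<open>p\<close>, so writing \<open>x = p z + r\<close> everything reduces by steps
  of \<open>1\<close> to the values at \<open>p z\<close>, where \<open>d k (p z) \<equiv> 1\<close> for \<open>k < p\<close> and
  \<open>d p (p z) \<equiv> 1 + 2 z\<close> modulo \<open>p\<close>.
\<close>

subsection \<open>Identities for the polynomials\<close>

lemma dpoly_0 [simp]: "dpoly 0 x = 1"
  by (simp add: dpoly_def)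

text \<open>The term \<open>j = n\<close> is zero because \<open>n choose Suc n = 0\<close>; keeping
  it gives all the sums below the same range, so that they combine term by term.\<close>

lemma dpoly_eq_sum_Suc:
  "dpoly n x = 1 + (\<Sum>j\<le>n. of_nat (n choose Suc j) * (x gchoose Suc j) * 2 ^ Suc j)"
proof -
  have "dpoly n x = (\<Sum>k\<le>Suc n. of_nat (n choose k) * (x gchoose k) * 2 ^ k)"
    by (simp add: dpoly_def atMost_atLeast0)
  also have "\<dots> = 1 + (\<Sum>j\<le>n. of_nat (n choose Suc j) * (x gchoose Suc j) * 2 ^ Suc j)"
    by (subst sum.atMost_Suc_shift) simp
  finally show ?thesis .
qed

lemma dpoly_plus_1:
  "dpoly n (x + 1) = dpoly n x + (\<Sum>j\<le>n. of_nat (n choose Suc j) * (x gchoose j) * 2 ^ Suc j)"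
  unfolding dpoly_eq_sum_Suc[of n "x + 1"] dpoly_eq_sum_Suc[of n x]
  by (simp add: gbinomial_Suc_Suc ring_distribs sum.distrib)

lemma dpoly_Suc_plus_1:
  "dpoly (Suc n) (x + 1) =
    dpoly (Suc n) x + (\<Sum>j\<le>n. of_nat (Suc n choose Suc j) * (x gchoose j) * 2 ^ Suc j)"
  unfolding dpoly_plus_1[of "Suc n"] by (subst sum.atMost_Suc) (simp add: binomial_eq_0)

lemma two_dpoly: "2 * dpoly n x = (\<Sum>j\<le>n. of_nat (n choose j) * (x gchoose j) * 2 ^ Suc j)"
  by (simp add: dpoly_def atMost_atLeast0 sum_distrib_left mult_ac)

text \<open>Pascal's rule for \<open>Suc n choose Suc j\<close> splits the difference on the left
  into \<open>2 * dpoly n x\<close> and \<open>dpoly n (x + 1) - dpoly n x\<close>.\<close>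

lemma dpoly_Suc_shift:
  "dpoly (Suc n) (x + 1) - dpoly (Suc n) x = dpoly n (x + 1) + dpoly n x"
proof -
  have "(\<Sum>j\<le>n. of_nat (Suc n choose Suc j) * (x gchoose j) * 2 ^ Suc j) =
      2 * dpoly n x + (\<Sum>j\<le>n. of_nat (n choose Suc j) * (x gchoose j) * 2 ^ Suc j)"
    unfolding two_dpoly sum.distrib[symmetric] by (intro sum.cong) (simp_all add: algebra_simps)
  then show ?thesis
    unfolding dpoly_Suc_plus_1 by (simp add: dpoly_plus_1[of n x])
qed

lemma dpoly_Suc:
  "dpoly (Suc n) x = dpoly n x + (\<Sum>j\<le>n. of_nat (n choose j) * (x gchoose Suc j) * 2 ^ Suc j)"
proof -
  have "dpoly (Suc n) x = 1 + (\<Sum>j\<le>n. of_nat (Suc n choose Suc j) * (x gchoose Suc j) * 2 ^ Suc j)"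
    unfolding dpoly_eq_sum_Suc[of "Suc n"] by (subst sum.atMost_Suc) (simp add: binomial_eq_0)
  also have "\<dots> = dpoly n x + (\<Sum>j\<le>n. of_nat (n choose j) * (x gchoose Suc j) * 2 ^ Suc j)"
    unfolding dpoly_eq_sum_Suc[of n x] add.assoc sum.distrib[symmetric]
    by (intro arg_cong2[of _ _ _ _ "(+)"] sum.cong) (simp_all add: algebra_simps)
  finally show ?thesis .
qed

text \<open>Two absorption identities trade the factor \<open>x + 1\<close> for \<open>Suc j\<close>
  and then \<open>Suc j\<close> for \<open>Suc n\<close>, term by term.\<close>

lemma dpoly_shift_mult_Suc:
  "(x + 1) * (dpoly (Suc n) (x + 1) - dpoly (Suc n) x) =
    of_nat (Suc n) * (dpoly (Suc n) x + dpoly n x)"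
proof -
  have *: "(x + 1) * (of_nat (Suc n choose Suc j) * (x gchoose j) * 2 ^ Suc j) =
      of_nat (Suc n) * (of_nat (n choose j) * (x gchoose Suc j) * 2 ^ Suc j +
        of_nat (n choose j) * (x gchoose j) * 2 ^ Suc j)" for j
  proof -
    have 1: "(x + 1) * (x gchoose j) = of_nat (Suc j) * ((x gchoose j) + (x gchoose Suc j))"
      using gbinomial_absorption[of j "x + 1"] by (simp add: gbinomial_Suc_Suc)
    have 2: "of_nat (Suc j) * of_nat (Suc n choose Suc j) = (of_nat (Suc n) * of_nat (n choose j) :: 'a)"
      using Suc_times_binomial[of j n] by (metis of_nat_mult)
    have "(x + 1) * (of_nat (Suc n choose Suc j) * (x gchoose j) * 2 ^ Suc j) =
      of_nat (Suc n choose Suc j) * ((x + 1) * (x gchoose j)) * 2 ^ Suc j"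
      by (simp only: mult_ac)
    also have "\<dots> = (of_nat (Suc j) * of_nat (Suc n choose Suc j)) *
        ((x gchoose j) + (x gchoose Suc j)) * 2 ^ Suc j"
      unfolding 1 by (simp only: mult_ac)
    finally show ?thesis
      unfolding 2 by (simp only: ring_distribs mult_ac add_ac)
  qed
  have "(x + 1) * (dpoly (Suc n) (x + 1) - dpoly (Suc n) x) =
      of_nat (Suc n) * ((\<Sum>j\<le>n. of_nat (n choose j) * (x gchoose Suc j) * 2 ^ Suc j) + 2 * dpoly n x)"
    unfolding dpoly_Suc_plus_1 two_dpoly add_diff_cancel_left' sum.distrib[symmetric]
      sum_distrib_left by (intro sum.cong refl *)
  then show ?thesis
    unfolding dpoly_Suc[of n x] by (simp only: mult_2 add_ac)
qed

text \<open>The truncated \<open>n - 1\<close> is harmless at \<open>n = 0\<close>, since its factor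
  \<open>of_nat n\<close> vanishes there.\<close>

lemma dpoly_shift_mult:
  "(x + 1) * (dpoly n (x + 1) - dpoly n x) = of_nat n * (dpoly n x + dpoly (n - 1) x)"
  using dpoly_shift_mult_Suc[of x "n - 1"] by (cases n) simp_all

text \<open>Subtracting the shift identities for \<open>n\<close> and \<open>Suc n\<close>
  eliminates the values at \<open>x + 1\<close>.\<close>

lemma dpoly_recurrence:
  "of_nat (Suc n) * dpoly (Suc n) x = (2 * x + 1) * dpoly n x + of_nat n * dpoly (n - 1) x"
proof -
  have "of_nat (Suc n) * (dpoly (Suc n) x + dpoly n x) - of_nat n * (dpoly n x + dpoly (n - 1) x) =
      (x + 1) * (dpoly n (x + 1) + dpoly n x) - (x + 1) * (dpoly n (x + 1) - dpoly n x)"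
    by (simp only: dpoly_shift_mult flip: dpoly_shift_mult_Suc dpoly_Suc_shift)
  then show ?thesis
    by (simp add: algebra_simps)
qed

text \<open>The map sending \<open>x\<close> to \<open>-1 - x\<close> negates
  \<open>2 * x + 1\<close>, the only coefficient of the recurrence that depends on
  \<open>x\<close>.\<close>

lemma dpoly_reflect: "dpoly n (-1 - x) = (-1) ^ n * dpoly n x"
proof (induction n rule: less_induct)
  case (less n)
  show ?case
  proof (cases n)
    case (Suc m)
    \<comment> \<open>At \<open>m = 0\<close> truncated subtraction would give the wrong sign for
      the predecessor; the factor \<open>of_nat m\<close> keeps the equation true.\<close>
    have IH: "dpoly m (-1 - x) = (-1) ^ m * dpoly m x"
      "of_nat m * dpoly (m - 1) (-1 - x) = - (of_nat m * ((-1) ^ m * dpoly (m - 1) x))"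
      using less[of m] less[of "m - 1"] Suc by (cases m; simp)+
    have "of_nat (Suc m) * dpoly (Suc m) (-1 - x) = of_nat (Suc m) * ((-1) ^ Suc m * dpoly (Suc m) x)"
      unfolding dpoly_recurrence IH mult.left_commute[of "of_nat (Suc m)"]
      by (simp add: algebra_simps)
    then show ?thesis
      using Suc mult_left_cancel[OF of_nat_neq_0] by blast
  qed simp
qed

lemma dpoly_minus_1: "dpoly n (x - 1) = (-1) ^ n * dpoly n (- x)"
  using dpoly_reflect[of n "- x"] by (simp add: algebra_simps)

text \<open>This is the forward identity at \<open>- x - 1\<close>, carried back by
  reflection.\<close>

lemma dpoly_backward_mult:
  "x * (dpoly n x - dpoly n (x - 1)) = of_nat n * (dpoly n x - dpoly (n - 1) x)"
proof -
  have "(- x) * (dpoly n (- x) - dpoly n (- x - 1)) = of_nat n * (dpoly n (- x - 1) + dpoly (n - 1) (- x - 1))"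
    using dpoly_shift_mult[of "- x - 1" n] by simp
  moreover have "dpoly n (- x - 1) = (-1) ^ n * dpoly n x"
    "dpoly (n - 1) (- x - 1) = (-1) ^ (n - 1) * dpoly (n - 1) x"
    unfolding minus_diff_commute[of x 1] by (simp_all only: dpoly_reflect)
  moreover have "dpoly n (- x) = (-1) ^ n * dpoly n (x - 1)"
    by (simp add: dpoly_minus_1 flip: power_mult_distrib mult.assoc)
  ultimately have "(-1) ^ n * (x * (dpoly n x - dpoly n (x - 1))) =
      (-1) ^ n * (of_nat n * (dpoly n x - dpoly (n - 1) x))"
    by (cases n) (simp_all add: algebra_simps)
  then show ?thesis
    by simp
qed

text \<open>By \<open>dpoly_Suc_shift\<close> the forward differences at \<open>n\<close> and
  \<open>Suc n\<close> are the difference and the sum of the same two values, so their squares add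
  up by the parallelogram law.\<close>

lemma sum_alternating_dpoly_square:
  "2 * ((\<Sum>k<n. (-1) ^ k * (dpoly k x)\<^sup>2) + (\<Sum>k<n. (-1) ^ k * (dpoly k (x + 1))\<^sup>2)) =
    - ((-1) ^ n * (dpoly n (x + 1) - dpoly n x)\<^sup>2)"
proof (induction n)
  case (Suc n)
  then show ?case
    unfolding dpoly_Suc_shift by (simp add: algebra_simps power2_eq_square)
qed simp

text \<open>The increment is the recurrence multiplied by \<open>dpoly n x\<close>.\<close>

lemma sum_dpoly_square:
  "(2 * x + 1) * (\<Sum>k<n. (dpoly k x)\<^sup>2) = of_nat n * dpoly n x * dpoly (n - 1) x"
proof (induction n)
  case (Suc n)
  then show ?case
    unfolding dpoly_recurrence by (simp add: algebra_simps power2_eq_square)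
qed simp

lemma sum_odd_weighted_dpoly_square:
  "4 * (\<Sum>k<n. of_nat (2 * k + 1) * (dpoly k x)\<^sup>2) =
    (x + 1) * (dpoly n (x + 1) - dpoly n x)\<^sup>2 - x * (dpoly n x - dpoly n (x - 1))\<^sup>2"
proof (induction n)
  case (Suc n)
  define S where "S = dpoly n (x + 1) - dpoly n x"
  define T where "T = dpoly n x - dpoly n (x - 1)"
  define u where "u = dpoly n x"
  have 1: "dpoly (Suc n) (x + 1) - dpoly (Suc n) x = S + 2 * u"
    unfolding dpoly_Suc_shift S_def u_def by simp
  have 2: "dpoly (Suc n) x - dpoly (Suc n) (x - 1) = 2 * u - T"
    using dpoly_Suc_shift[of n "x - 1"] unfolding T_def u_def by simp
  \<comment> \<open>The values at \<open>n - 1\<close> cancel between the two identities. The cross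
    terms of the expanded squares then collapse to a multiple of \<open>u\<^sup>2\<close>, which
    produces the weight \<open>2 * n + 1\<close>.\<close>
  have 3: "(x + 1) * S + x * T = of_nat (2 * n) * u"
    unfolding S_def T_def u_def dpoly_shift_mult dpoly_backward_mult by (simp add: algebra_simps)
  have "(x + 1) * (S + 2 * u)\<^sup>2 - x * (2 * u - T)\<^sup>2 =
      (x + 1) * S\<^sup>2 - x * T\<^sup>2 + 4 * u\<^sup>2 + 4 * u * ((x + 1) * S + x * T)"
    by (simp add: algebra_simps power2_eq_square)
  also have "\<dots> = (x + 1) * S\<^sup>2 - x * T\<^sup>2 + 4 * (of_nat (2 * n + 1) * u\<^sup>2)"
    unfolding 3 by (simp add: algebra_simps power2_eq_square)
  finally show ?case
    using Suc[folded S_def T_def] unfolding 1 2 sum.lessThan_Suc distrib_left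
    by (simp add: u_def)
qed simp

subsection \<open>Divisibility and congruences of p-adic numbers\<close>

lemma padic_residue_1_eq_0_imp_dvd:
  fixes a :: "'p :: prime_card padic_int"
  assumes "padic_residue a 1 = 0"
  shows "of_nat CARD('p) dvd a"
proof -
  let ?P = "int CARD('p)"
  have P: "?P > 0"
    using CARD_power_pos[where 'p = 'p, of 1] by simp
  \<comment> \<open>Division by \<open>p\<close> costs one digit of precision, hence the shift of
    the index.\<close>
  define g where "g = (\<lambda>n. padic_residue a (Suc n) div ?P)"
  have dvd: "?P dvd padic_residue a (Suc n)" for n
    using padic_residue_add_mod[of a 1 n] assms by (simp add: dvd_eq_mod_eq_0)
  have range: "g n \<in> {0..<?P ^ n}" for n
  proof -
    have "?P * g n \<in> {0..<?P * ?P ^ n}"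
      using padic_residue[of a] dvd[of n] by (auto simp: g_def dest!: spec[of _ "Suc n"])
    then show ?thesis
      using P by (simp add: zero_le_mult_iff)
  qed
  have coh: "g (Suc n) mod ?P ^ n = g n" for n
  proof -
    have "padic_residue a (Suc (Suc n)) mod (?P * ?P ^ n) = padic_residue a (Suc n)"
      using padic_residue_Suc_mod[of a "Suc n"] by simp
    then have "?P * (g (Suc n) mod ?P ^ n) = ?P * g n"
      unfolding g_def mult_mod_right using dvd[of n] dvd[of "Suc n"] by simp
    then show ?thesis
      using P by simp
  qed
  have b: "padic_residue (Abs_padic_int g :: 'p padic_int) = g"
    using range coh by (intro Abs_padic_int_inverse) blast
  have "padic_residue (of_nat CARD('p) * Abs_padic_int g :: 'p padic_int) n = padic_residue a n" for n
  proof -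
    have "padic_residue (of_nat CARD('p) * Abs_padic_int g :: 'p padic_int) n = ?P * g n mod ?P ^ n"
      by (simp add: times_padic_int.rep_eq padic_residue_of_nat b mod_simps)
    also have "?P * g n = padic_residue a (Suc n)"
      unfolding g_def using dvd[of n] by simp
    finally show ?thesis
      by (simp add: padic_residue_Suc_mod)
  qed
  then have "a = of_nat CARD('p) * Abs_padic_int g"
    by (metis ext padic_residue_inject)
  then show ?thesis ..
qed

text \<open>Each residue is invertible modulo its power of \<open>p\<close>, and uniqueness of
  inverses makes the chosen inverses coherent.\<close>

lemma padic_residue_1_neq_0_imp_unit:
  fixes a :: "'p :: prime_card padic_int"
  assumes "padic_residue a 1 \<noteq> 0"
  shows "a dvd 1"
proof -
  let ?P = "int CARD('p)"
  have coprime: "coprime (padic_residue a n) (?P ^ n)" for n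
  proof (cases n)
    case (Suc m)
    have "\<not> ?P dvd padic_residue a n"
      using padic_residue_add_mod[of a 1 m] assms Suc by (simp add: dvd_eq_mod_eq_0)
    then show ?thesis
      using prime_imp_coprime[OF prime_card_int[where 'a = 'p]] by (simp add: coprime_commute)
  qed simp
  then have "\<forall>n. \<exists>h. [padic_residue a n * h = 1] (mod ?P ^ n)"
    using cong_solve_coprime_int by blast
  then obtain h where h: "\<And>n. [padic_residue a n * h n = 1] (mod ?P ^ n)"
    by metis
  have coh: "h (Suc n) mod ?P ^ n = h n mod ?P ^ n" for n
  proof -
    have "[padic_residue a (Suc n) * h (Suc n) = 1] (mod ?P ^ n)"
      using h[of "Suc n"] by (rule cong_dvd_modulus) simp
    moreover have "[padic_residue a (Suc n) = padic_residue a n] (mod ?P ^ n)"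
      by (simp add: cong_def padic_residue_Suc_mod padic_residue_mod)
    ultimately have "[padic_residue a n * h (Suc n) = padic_residue a n * h n] (mod ?P ^ n)"
      using h[of n] by (metis cong_scalar_right cong_sym cong_trans)
    then show ?thesis
      using cong_mult_lcancel[OF coprime[of n]] by (simp only: cong_def)
  qed
  define g where "g = (\<lambda>n. h n mod ?P ^ n)"
  have b: "padic_residue (Abs_padic_int g :: 'p padic_int) = g"
    unfolding g_def using padic_closed[where 'p = 'p, OF coh]
    by (intro Abs_padic_int_inverse) blast
  have "padic_residue (a * Abs_padic_int g) n = padic_residue (1 :: 'p padic_int) n" for n
    using h[of n] unfolding times_padic_int.rep_eq one_padic_int.rep_eq b
    by (simp add: g_def mod_simps cong_def)
  then have "1 = a * Abs_padic_int g"
    by (metis ext padic_residue_inject)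
  then show ?thesis ..
qed

section \<open>The ring of p-adic integers inside its fraction field, and the calculus of
  congruences\<close>

lemma to_fract_of_nat: "to_fract (of_nat k) = of_nat k"
  by (induction k) simp_all

lemma padic_Ints_closed [simp, intro]:
  fixes a b :: "'p :: prime_card padic"
  shows "0 \<in> (padic_Ints :: 'p padic set)" "1 \<in> (padic_Ints :: 'p padic set)"
    "numeral w \<in> (padic_Ints :: 'p padic set)" "of_nat k \<in> (padic_Ints :: 'p padic set)"
    "a \<in> padic_Ints \<Longrightarrow> - a \<in> padic_Ints"
    "a \<in> padic_Ints \<Longrightarrow> b \<in> padic_Ints \<Longrightarrow> a + b \<in> padic_Ints"
    "a \<in> padic_Ints \<Longrightarrow> b \<in> padic_Ints \<Longrightarrow> a - b \<in> padic_Ints"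
    "a \<in> padic_Ints \<Longrightarrow> b \<in> padic_Ints \<Longrightarrow> a * b \<in> padic_Ints"
proof -
  show *: "of_nat k \<in> (padic_Ints :: 'p padic set)" for k
    unfolding padic_Ints_def by (metis rangeI to_fract_of_nat)
  show "0 \<in> (padic_Ints :: 'p padic set)" "1 \<in> (padic_Ints :: 'p padic set)"
    "numeral w \<in> (padic_Ints :: 'p padic set)"
    using *[of 0] *[of 1] *[of "numeral w"] by simp_all
qed (auto simp: padic_Ints_def simp flip: to_fract_uminus to_fract_add to_fract_diff to_fract_mult)

lemma padic_Ints_power [simp, intro]: "a \<in> padic_Ints \<Longrightarrow> a ^ n \<in> padic_Ints"
  by (induction n) auto

lemma of_nat_CARD_padic_neq_0 [simp]: "of_nat CARD('p) \<noteq> (0 :: 'p :: prime_card padic)"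
  by simp

lemma padic_cong_iff:
  fixes a b :: "'p :: prime_card padic"
  shows "padic_cong a b m \<longleftrightarrow> (\<exists>z\<in>padic_Ints. a = b + of_nat CARD('p) ^ m * z)"
proof
  assume "padic_cong a b m"
  then show "\<exists>z\<in>padic_Ints. a = b + of_nat CARD('p) ^ m * z"
    unfolding padic_cong_def by (intro bexI[of _ "(a - b) / of_nat CARD('p) ^ m"]) simp_all
qed (auto simp: padic_cong_def)

lemma padic_cong_refl [simp]: "padic_cong a a m"
  by (simp add: padic_cong_def)

lemma padic_cong_0_iff: "padic_cong (a - b) 0 m \<longleftrightarrow> padic_cong a b m"
  by (simp add: padic_cong_def)

lemma padic_cong_sym: "padic_cong a b m \<Longrightarrow> padic_cong b a m"
  using padic_Ints_closed(5) unfolding padic_cong_def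
  by (metis minus_diff_eq minus_divide_left)

lemma padic_cong_add:
  "padic_cong a b m \<Longrightarrow> padic_cong c d m \<Longrightarrow> padic_cong (a + c) (b + d) m"
  unfolding padic_cong_def add_diff_add add_divide_distrib by (rule padic_Ints_closed)

lemma padic_cong_trans [trans]:
  "padic_cong a b m \<Longrightarrow> padic_cong b c m \<Longrightarrow> padic_cong a c m"
  using padic_cong_add[of a b m b c] by (simp add: padic_cong_def)

lemma padic_cong_scale:
  "c \<in> padic_Ints \<Longrightarrow> padic_cong a b m \<Longrightarrow> padic_cong (c * a) (c * b) m"
  using padic_Ints_closed(8)[of c "(a - b) / _"]
  by (simp add: padic_cong_def right_diff_distrib)

lemma padic_cong_minus: "padic_cong a b m \<Longrightarrow> padic_cong (- a) (- b) m"
  using padic_cong_scale[of "-1" a b m] by simp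

lemma padic_cong_diff:
  "padic_cong a b m \<Longrightarrow> padic_cong c d m \<Longrightarrow> padic_cong (a - c) (b - d) m"
  using padic_cong_add[OF _ padic_cong_minus, of a b m c d] by simp

text \<open>The integrality hypotheses match the splitting
  \<open>a * c - b * d = a * (c - d) + d * (a - b)\<close>.\<close>

lemma padic_cong_mult:
  assumes "padic_cong a b m" "padic_cong c d m" "a \<in> padic_Ints" "d \<in> padic_Ints"
  shows "padic_cong (a * c) (b * d) m"
  using padic_cong_scale[OF assms(3,2)] padic_cong_scale[OF assms(4,1)]
  by (auto intro: padic_cong_trans simp: mult.commute)

lemma padic_cong_sum:
  "(\<And>k. k \<in> A \<Longrightarrow> padic_cong (f k) (g k) m) \<Longrightarrow> padic_cong (sum f A) (sum g A) m"
  by (induction A rule: infinite_finite_induct) (auto intro: padic_cong_add)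

lemma padic_cong_mult_0:
  "padic_cong a 0 m \<Longrightarrow> padic_cong b 0 n \<Longrightarrow> padic_cong (a * b) 0 (m + n)"
  using padic_Ints_closed(8)[of "a / of_nat CARD(_) ^ m" "b / of_nat CARD(_) ^ n"]
  by (simp add: padic_cong_def power_add)

text \<open>A factor divisible by a power of \<open>p\<close> raises the precision; this is how
  congruences modulo \<open>p\<close> yield ones modulo \<open>p\<^sup>2\<close>.\<close>

lemma padic_cong_scale_0:
  assumes "padic_cong c 0 m" "padic_cong a b n"
  shows "padic_cong (c * a) (c * b) (m + n)"
proof -
  have "padic_cong (c * (a - b)) 0 (m + n)"
    using assms by (intro padic_cong_mult_0) (simp_all add: padic_cong_0_iff)
  then show ?thesis
    by (simp add: right_diff_distrib padic_cong_0_iff)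
qed

lemma padic_cong_CARD_mult:
  fixes z :: "'p :: prime_card padic"
  shows "z \<in> padic_Ints \<Longrightarrow> padic_cong (of_nat CARD('p) * z) 0 1"
  by (simp add: padic_cong_def)

lemma padic_cong_imp_Ints:
  fixes a b :: "'p :: prime_card padic"
  shows "padic_cong a b m \<Longrightarrow> b \<in> padic_Ints \<Longrightarrow> a \<in> padic_Ints"
  by (auto simp: padic_cong_iff)

lemma padic_inverse_Ints:
  fixes a :: "'p :: prime_card padic"
  assumes "a \<in> padic_Ints" "\<not> padic_cong a 0 1"
  shows "inverse a \<in> padic_Ints"
proof -
  obtain b where b: "a = to_fract b"
    using assms(1) by (auto simp: padic_Ints_def)
  have "padic_residue b 1 \<noteq> 0"
  proof
    assume "padic_residue b 1 = 0"
    then obtain c where "b = of_nat CARD('p) * c"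
      using padic_residue_1_eq_0_imp_dvd by blast
    then have "a = of_nat CARD('p) * to_fract c"
      by (simp add: b to_fract_of_nat)
    then show False
      using assms(2) padic_cong_CARD_mult[of "to_fract c"] unfolding padic_Ints_def by blast
  qed
  then obtain c where "b * c = 1"
    using padic_residue_1_neq_0_imp_unit by (metis dvdE)
  then have "a * to_fract c = 1"
    unfolding b by (metis to_fract_1 to_fract_mult)
  then have "inverse a = to_fract c"
    by (rule inverse_unique)
  then show ?thesis
    by (simp add: padic_Ints_def)
qed

text \<open>The inverse of \<open>c\<close> is integral, so multiplying by it loses no precision. It
  serves for division by \<open>2\<close>, by indices below \<open>p\<close>, and by
  \<open>x + 1\<close> or \<open>2 * x + 1\<close> when these are units.\<close>

lemma padic_cong_cancel:
  assumes "c \<in> padic_Ints" "\<not> padic_cong c 0 1" "padic_cong (c * a) (c * b) m"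
  shows "padic_cong a b m"
proof -
  have "c \<noteq> 0"
    using assms(2) by auto
  then show ?thesis
    using padic_cong_scale[OF padic_inverse_Ints[OF assms(1,2)] assms(3)]
    by (simp flip: mult.assoc)
qed

text \<open>Injectivity of \<open>to_fract\<close> pulls the relation back to the inverse limit,
  where the first residue decides it.\<close>

lemma padic_cong_of_nat_0_iff:
  "padic_cong (of_nat k :: 'p :: prime_card padic) 0 1 \<longleftrightarrow> CARD('p) dvd k"
proof
  assume "padic_cong (of_nat k :: 'p padic) 0 1"
  then obtain c where "(of_nat k :: 'p padic) = of_nat CARD('p) * to_fract c"
    by (auto simp: padic_cong_iff padic_Ints_def)
  then have "to_fract (of_nat k :: 'p padic_int) = to_fract (of_nat CARD('p) * c)"
    by (simp add: to_fract_of_nat)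
  then have "(of_nat k :: 'p padic_int) = of_nat CARD('p) * c"
    by (simp only: to_fract_eq_iff)
  then have "padic_residue (of_nat k :: 'p padic_int) 1 = padic_residue (of_nat CARD('p) * c) 1"
    by (rule arg_cong)
  then have "int k mod int CARD('p) = 0"
    by (simp add: padic_residue_of_nat times_padic_int.rep_eq)
  then show "CARD('p) dvd k"
    by presburger
qed (metis dvd_def of_nat_mult padic_Ints_closed(4) padic_cong_CARD_mult)

text \<open>The first entry of the residue sequence is the witness; its existence makes the
  \<open>LEAST\<close> in \<open>padic_least_residue\<close> meaningful.\<close>

lemma ex_padic_residue:
  fixes x :: "'p :: prime_card padic"
  assumes "x \<in> padic_Ints"
  shows "\<exists>r<CARD('p). padic_cong x (of_nat r) 1"
proof -
  obtain a where a: "x = to_fract a"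
    using assms by (auto simp: padic_Ints_def)
  define r where "r = nat (padic_residue a 1)"
  have r: "int r = padic_residue a 1" "r < CARD('p)"
    using padic_residue[of a] by (auto simp: r_def dest!: spec[of _ 1])
  have "padic_residue (a - of_nat r) 1 = 0"
    using r by (simp add: minus_padic_int.rep_eq padic_residue_of_nat)
  then obtain c where "a - of_nat r = of_nat CARD('p) * c"
    using padic_residue_1_eq_0_imp_dvd by blast
  then have "to_fract (a - of_nat r) = to_fract (of_nat CARD('p) * c)"
    by simp
  then have "padic_cong (x - of_nat r) 0 1"
    using padic_cong_CARD_mult[of "to_fract c"]
    by (simp add: a to_fract_of_nat padic_Ints_def)
  then show ?thesis
    using r by (auto simp: padic_cong_0_iff)
qed

lemma padic_least_residue:
  fixes x :: "'p :: prime_card padic"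
  assumes "x \<in> padic_Ints"
  shows "padic_cong x (of_nat (padic_least_residue x)) 1" "padic_least_residue x < CARD('p)"
  using ex_padic_residue[OF assms] unfolding padic_least_residue_def
  by (auto intro: LeastI Least_le[THEN le_less_trans])

subsection \<open>Values modulo the prime\<close>

lemma padic_of_nat_not_cong_0:
  "0 < k \<Longrightarrow> k < CARD('p) \<Longrightarrow> \<not> padic_cong (of_nat k :: 'p :: prime_card padic) 0 1"
  unfolding padic_cong_of_nat_0_iff using nat_dvd_not_less by blast

text \<open>For indices below \<open>p\<close> the recurrence divides only by units.\<close>

lemma dpoly_padic_Ints:
  fixes x :: "'p :: prime_card padic"
  assumes "x \<in> padic_Ints" "k < CARD('p)"
  shows "dpoly k x \<in> padic_Ints"
  using assms(2)
proof (induction k rule: less_induct)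
  case (less k)
  show ?case
  proof (cases k)
    case (Suc n)
    have "inverse (of_nat (Suc n)) * (of_nat (Suc n) * dpoly (Suc n) x) \<in> padic_Ints"
      unfolding dpoly_recurrence using less Suc assms(1)
      by (intro padic_Ints_closed padic_inverse_Ints padic_of_nat_not_cong_0) auto
    then show ?thesis
      by (simp add: Suc flip: mult.assoc del: of_nat_Suc)
  qed simp
qed

lemma dpoly_padic_cong:
  fixes x y :: "'p :: prime_card padic"
  assumes "x \<in> padic_Ints" "y \<in> padic_Ints" "padic_cong x y m" "k < CARD('p)"
  shows "padic_cong (dpoly k x) (dpoly k y) m"
  using assms(4)
proof (induction k rule: less_induct)
  case (less k)
  show ?case
  proof (cases k)
    case (Suc n)
    have "padic_cong (of_nat (Suc n) * dpoly (Suc n) x) (of_nat (Suc n) * dpoly (Suc n) y) m"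
      unfolding dpoly_recurrence using less Suc assms(1-3)
      by (intro padic_cong_add padic_cong_mult padic_cong_scale padic_cong_refl padic_Ints_closed
          dpoly_padic_Ints) auto
    then show ?thesis
      unfolding Suc
      by (rule padic_cong_cancel[OF padic_Ints_closed(4) padic_of_nat_not_cong_0, rotated 2])
        (use less.prems Suc in auto)
  qed simp
qed

section \<open>Values at multiples of \<open>p\<close>, and values at the indices \<open>p\<close>
  and \<open>p - 1\<close>\<close>

lemma dpoly_0_right: "dpoly n 0 = 1"
  using dpoly_eq_sum_Suc[of n 0] by simp

lemma dpoly_padic_cong_1:
  fixes x :: "'p :: prime_card padic"
  assumes "padic_cong x 0 1" "k < CARD('p)"
  shows "padic_cong (dpoly k x) 1 1" "padic_cong (dpoly k (- x)) 1 1"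
proof -
  have x: "x \<in> padic_Ints"
    using assms(1) by (rule padic_cong_imp_Ints) simp
  then show "padic_cong (dpoly k x) 1 1" "padic_cong (dpoly k (- x)) 1 1"
    using dpoly_padic_cong[of x 0 1 k] dpoly_padic_cong[of "- x" 0 1 k] assms
      padic_cong_minus[OF assms(1)]
    by (simp_all add: dpoly_0_right)
qed

text \<open>In \<open>dpoly_shift_mult\<close> the index \<open>p\<close> is itself a factor, and
  the unit \<open>x + 1\<close> can be cancelled. Integrality at index \<open>p\<close> is a
  hypothesis because the induction in \<open>dpoly_CARD\<close> supplies it along the way.\<close>

lemma dpoly_CARD_shift_cong_0:
  fixes x :: "'p :: prime_card padic"
  assumes "x \<in> padic_Ints" "dpoly CARD('p) x \<in> padic_Ints" "\<not> padic_cong (x + 1) 0 1"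
  shows "padic_cong (dpoly CARD('p) (x + 1) - dpoly CARD('p) x) 0 1"
proof (rule padic_cong_cancel)
  show "x + 1 \<in> padic_Ints"
    using assms(1) by simp
  have "dpoly (CARD('p) - 1) x \<in> padic_Ints"
    using assms(1) by (intro dpoly_padic_Ints) simp_all
  then show "padic_cong ((x + 1) * (dpoly CARD('p) (x + 1) - dpoly CARD('p) x)) ((x + 1) * 0) 1"
    unfolding dpoly_shift_mult mult_zero_right using assms
    by (intro padic_cong_CARD_mult padic_Ints_closed)
qed fact

lemma Suc_CARD_minus_1: "Suc (CARD('p :: prime_card) - 1) = CARD('p)"
  by simp

text \<open>Walking from \<open>p * z\<close> up to \<open>p * z + r\<close> with
  \<open>r < p\<close> never steps from the residue class of \<open>- 1\<close>, the only one where
  the shift argument fails.\<close>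

lemma padic_residue_step_not_cong_0:
  fixes z :: "'p :: prime_card padic"
  assumes "z \<in> padic_Ints" "Suc r < CARD('p)"
  shows "\<not> padic_cong (of_nat CARD('p) * z + of_nat r + 1) 0 1"
proof
  assume "padic_cong (of_nat CARD('p) * z + of_nat r + 1) 0 1"
  from padic_cong_diff[OF this padic_cong_CARD_mult[OF assms(1)]]
  have "padic_cong (of_nat (Suc r) :: 'p padic) 0 1"
    by (simp add: add_ac)
  then show False
    using padic_of_nat_not_cong_0[where 'p = 'p, of "Suc r"] assms(2) by simp
qed

lemma dpoly_CARD:
  fixes z :: "'p :: prime_card padic"
  assumes "odd CARD('p)" "z \<in> padic_Ints" "r < CARD('p)"
  shows "padic_cong (dpoly CARD('p) (of_nat CARD('p) * z + of_nat r)) (1 + 2 * z) 1"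
  using assms(3)
proof (induction r)
  case 0
  define y where "y = of_nat CARD('p) * z"
  let ?q = "CARD('p) - 1"
  have q: "?q < CARD('p)" "even ?q"
    using assms(1) by simp_all
  have y: "padic_cong y 0 1"
    unfolding y_def using assms(2) by (rule padic_cong_CARD_mult)
  \<comment> \<open>Since \<open>y = p * z\<close>, both sides carry a factor \<open>p\<close>,
    which is cancelled in an exact equation before passing to congruences. Evenness of
    \<open>p - 1\<close> turns the value at \<open>y - 1\<close> into the one at
    \<open>- y\<close>.\<close>
  have "of_nat CARD('p) * (dpoly CARD('p) y - dpoly ?q y) = y * (dpoly CARD('p) y - dpoly CARD('p) (y - 1))"
    by (rule dpoly_backward_mult[symmetric])
  also have "\<dots> = of_nat CARD('p) * (z * (dpoly ?q y + dpoly ?q (- y)))"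
    using dpoly_Suc_shift[of ?q "y - 1"] q(2)
    unfolding Suc_CARD_minus_1 dpoly_minus_1[of ?q] by (simp add: y_def mult.assoc)
  finally have "dpoly CARD('p) y = dpoly ?q y + z * (dpoly ?q y + dpoly ?q (- y))"
    unfolding mult_left_cancel[OF of_nat_CARD_padic_neq_0] by (simp only: diff_eq_eq add.commute)
  also have "padic_cong \<dots> (1 + z * (1 + 1)) 1"
    using assms(2) y q(1) by (intro padic_cong_add padic_cong_scale dpoly_padic_cong_1)
  finally show ?case
    by (simp add: y_def algebra_simps)
next
  case (Suc r)
  let ?x = "of_nat CARD('p) * z + of_nat r"
  have IH: "padic_cong (dpoly CARD('p) ?x) (1 + 2 * z) 1"
    using Suc by simp
  then have "dpoly CARD('p) ?x \<in> padic_Ints"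
    by (rule padic_cong_imp_Ints) (use assms in auto)
  then have "padic_cong (dpoly CARD('p) (?x + 1) - dpoly CARD('p) ?x) 0 1"
    using assms(2) Suc.prems
    by (intro dpoly_CARD_shift_cong_0 padic_residue_step_not_cong_0) auto
  from padic_cong_add[OF this IH] show ?case
    by (simp add: add_ac)
qed

lemma padic_eq_CARD_mult_plus_residue:
  fixes x :: "'p :: prime_card padic"
  assumes "x \<in> padic_Ints"
  obtains z where "z \<in> padic_Ints" "x = of_nat CARD('p) * z + of_nat (padic_least_residue x)"
  using padic_least_residue(1)[OF assms] unfolding padic_cong_iff by (auto simp: add.commute)

lemma dpoly_CARD_padic_Ints:
  fixes x :: "'p :: prime_card padic"
  assumes "odd CARD('p)" "x \<in> padic_Ints"
  shows "dpoly CARD('p) x \<in> padic_Ints"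
proof -
  obtain z where z: "z \<in> padic_Ints" "x = of_nat CARD('p) * z + of_nat (padic_least_residue x)"
    using assms(2) by (rule padic_eq_CARD_mult_plus_residue)
  have "padic_cong (dpoly CARD('p) x) (1 + 2 * z) 1"
    using dpoly_CARD[OF assms(1) z(1) padic_least_residue(2)[OF assms(2)]] z(2) by simp
  then show ?thesis
    by (rule padic_cong_imp_Ints) (use z in auto)
qed

text \<open>The forward difference at index \<open>p\<close> is the sum of two neighbouring values
  at index \<open>p - 1\<close>; it vanishes modulo \<open>p\<close>, so each step flips the
  sign.\<close>

lemma dpoly_CARD_minus_1:
  fixes z :: "'p :: prime_card padic"
  assumes "odd CARD('p)" "z \<in> padic_Ints" "r < CARD('p)"
  shows "padic_cong (dpoly (CARD('p) - 1) (of_nat CARD('p) * z + of_nat r)) ((-1) ^ r) 1"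
  using assms(3)
proof (induction r)
  case 0
  show ?case
    using dpoly_padic_cong_1(1)[OF padic_cong_CARD_mult[OF assms(2)], of "CARD('p) - 1"] by simp
next
  case (Suc r)
  let ?x = "of_nat CARD('p) * z + of_nat r"
  have IH: "padic_cong (dpoly (CARD('p) - 1) ?x) ((-1) ^ r) 1"
    using Suc by simp
  have "padic_cong (dpoly CARD('p) (?x + 1) - dpoly CARD('p) ?x) 0 1"
    using assms Suc.prems
    by (intro dpoly_CARD_shift_cong_0 padic_residue_step_not_cong_0 dpoly_CARD_padic_Ints) auto
  then have "padic_cong (dpoly (CARD('p) - 1) (?x + 1) + dpoly (CARD('p) - 1) ?x) 0 1"
    using dpoly_Suc_shift[of "CARD('p) - 1" ?x] unfolding Suc_CARD_minus_1 by simp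
  from padic_cong_diff[OF this IH] show ?case
    by (simp add: add_ac)
qed

lemma padic_2_not_cong_0:
  "odd CARD('p) \<Longrightarrow> \<not> padic_cong (2 :: 'p :: prime_card padic) 0 1"
  using padic_cong_of_nat_0_iff[where 'p = 'p, of 2] prime_card[where 'a = 'p]
  by (metis of_nat_numeral primes_dvd_imp_eq two_is_prime_nat even_numeral)

section \<open>The three sums modulo the square of \<open>p\<close>\<close>

lemma sum_alternating_pairs:
  fixes g :: "nat \<Rightarrow> 'a :: comm_ring_1"
  shows "(\<Sum>k<2 * m + 1. (-1) ^ k * g k) = g 0 + (\<Sum>i<m. g (2 * i + 2) - g (2 * i + 1))"
  by (induction m) (simp_all add: algebra_simps)

text \<open>At multiples of \<open>p\<close> the terms of index \<open>2 * i + 1\<close> and \<open>2 * i + 2\<close> agree modulo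
  \<open>p\<^sup>2\<close> up to sign, which leaves only the term of index \<open>0\<close>.\<close>

lemma sum_alternating_dpoly_square_CARD_mult:
  fixes z :: "'p :: prime_card padic"
  assumes "odd CARD('p)" "z \<in> padic_Ints"
  shows "padic_cong (\<Sum>k<CARD('p). (-1) ^ k * (dpoly k (of_nat CARD('p) * z))\<^sup>2) 1 2"
proof -
  define y where "y = of_nat CARD('p) * z"
  have y: "padic_cong y 0 1" "y \<in> padic_Ints"
    unfolding y_def using assms(2) by (auto intro!: padic_cong_CARD_mult simp del: One_nat_def)
  obtain m where m: "CARD('p) = 2 * m + 1"
    using assms(1) by (rule oddE)
  have pair: "padic_cong ((dpoly (2 * i + 2) y)\<^sup>2 - (dpoly (2 * i + 1) y)\<^sup>2) 0 2" if "i < m" for i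
  proof -
    let ?n = "2 * i + 2"
    have n: "?n < CARD('p)" "2 * i + 1 < CARD('p)"
      using that m by simp_all
    \<comment> \<open>Both values are \<open>1\<close> modulo \<open>p\<close>, and the factor
      \<open>y\<close> contributes a second power of \<open>p\<close>. As \<open>?n\<close> is even,
      \<open>dpoly_backward_mult\<close> identifies this product with a multiple of the difference
      of neighbouring values.\<close>
    have "padic_cong (y * (dpoly ?n y - dpoly ?n (- y))) (y * (1 - 1)) (1 + 1)"
      using y n by (intro padic_cong_scale_0 padic_cong_diff dpoly_padic_cong_1)
    moreover have "y * (dpoly ?n y - dpoly ?n (- y)) = of_nat ?n * (dpoly ?n y - dpoly (2 * i + 1) y)"
      using dpoly_backward_mult[of y ?n] unfolding dpoly_minus_1 by simp
    ultimately have "padic_cong (of_nat ?n * (dpoly ?n y - dpoly (2 * i + 1) y)) (of_nat ?n * 0) 2"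
      unfolding one_add_one by (simp only: diff_self mult_zero_right)
    then have "padic_cong (dpoly ?n y - dpoly (2 * i + 1) y) 0 2"
      by (rule padic_cong_cancel[OF padic_Ints_closed(4) padic_of_nat_not_cong_0, rotated 2])
        (use n in auto)
    then have "padic_cong ((dpoly ?n y + dpoly (2 * i + 1) y) * (dpoly ?n y - dpoly (2 * i + 1) y))
        ((dpoly ?n y + dpoly (2 * i + 1) y) * 0) 2"
      using y n by (intro padic_cong_scale padic_Ints_closed dpoly_padic_Ints)
    then show ?thesis
      by (simp add: algebra_simps power2_eq_square)
  qed
  have "padic_cong (1 + (\<Sum>i<m. (dpoly (2 * i + 2) y)\<^sup>2 - (dpoly (2 * i + 1) y)\<^sup>2)) (1 + (\<Sum>i<m. 0)) 2"
    using pair by (intro padic_cong_add padic_cong_sum padic_cong_refl) auto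
  moreover have "(\<Sum>k<CARD('p). (-1) ^ k * (dpoly k y)\<^sup>2) =
      1 + (\<Sum>i<m. (dpoly (2 * i + 2) y)\<^sup>2 - (dpoly (2 * i + 1) y)\<^sup>2)"
    unfolding m sum_alternating_pairs by simp
  ultimately show ?thesis
    unfolding y_def[symmetric] by simp
qed

text \<open>The sums at \<open>x\<close> and \<open>x + 1\<close> add up to half a square, up to
  sign; away from the class of \<open>- 1\<close> its base is divisible by \<open>p\<close>, so one
  step negates the sum modulo \<open>p\<^sup>2\<close>.\<close>

lemma sum_alternating_dpoly_square_cong:
  fixes z :: "'p :: prime_card padic"
  assumes "odd CARD('p)" "z \<in> padic_Ints" "r < CARD('p)"
  shows "padic_cong (\<Sum>k<CARD('p). (-1) ^ k * (dpoly k (of_nat CARD('p) * z + of_nat r))\<^sup>2) ((-1) ^ r) 2"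
  using assms(3)
proof (induction r)
  case 0
  show ?case
    using sum_alternating_dpoly_square_CARD_mult[OF assms(1,2)] by simp
next
  case (Suc r)
  let ?x = "of_nat CARD('p) * z + of_nat r"
  let ?F = "\<lambda>x. (\<Sum>k<CARD('p). (-1) ^ k * (dpoly k x)\<^sup>2)"
  have IH: "padic_cong (?F ?x) ((-1) ^ r) 2"
    using Suc by simp
  have *: "padic_cong (dpoly CARD('p) (?x + 1) - dpoly CARD('p) ?x) 0 1"
    using assms Suc.prems
    by (intro dpoly_CARD_shift_cong_0 padic_residue_step_not_cong_0 dpoly_CARD_padic_Ints) auto
  have "padic_cong (2 * (?F ?x + ?F (?x + 1))) (2 * 0) 2"
    using padic_cong_mult_0[OF * *] assms(1) unfolding sum_alternating_dpoly_square
    by (simp add: power2_eq_square numeral_2_eq_2)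
  then have "padic_cong (?F ?x + ?F (?x + 1)) 0 2"
    by (rule padic_cong_cancel[rotated 2]) (use assms(1) padic_2_not_cong_0 in auto)
  from padic_cong_diff[OF this IH] show ?case
    by (simp add: add_ac)
qed

text \<open>Both terms of the closed form of the weighted sum have this shape, at
  \<open>x + 1\<close> and at \<open>x\<close>. If \<open>p\<close> divides \<open>x\<close>, the
  difference is \<open>2\<close> modulo \<open>p\<close> and the factor \<open>x\<close> lifts its
  square to precision two; otherwise the difference is divisible by \<open>p\<close>.\<close>

lemma dpoly_CARD_backward_square_cong:
  fixes x :: "'p :: prime_card padic"
  assumes "odd CARD('p)" "x \<in> padic_Ints"
  shows "padic_cong (x * (dpoly CARD('p) x - dpoly CARD('p) (x - 1))\<^sup>2)
    (if padic_cong x 0 1 then 4 * x else 0) 2"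
proof (cases "padic_cong x 0 1")
  case True
  let ?q = "CARD('p) - 1"
  have q: "?q < CARD('p)" "even ?q"
    using assms(1) by simp_all
  have "dpoly CARD('p) x - dpoly CARD('p) (x - 1) = dpoly ?q x + dpoly ?q (- x)"
    using dpoly_Suc_shift[of ?q "x - 1"] q(2)
    unfolding Suc_CARD_minus_1 dpoly_minus_1[of ?q] by simp
  also have "padic_cong \<dots> (1 + 1) 1"
    using True q by (intro padic_cong_add dpoly_padic_cong_1)
  finally have T: "padic_cong (dpoly CARD('p) x - dpoly CARD('p) (x - 1)) (1 + 1) 1" .
  have "padic_cong ((dpoly CARD('p) x - dpoly CARD('p) (x - 1))\<^sup>2) ((1 + 1) * (1 + 1)) 1"
    unfolding power2_eq_square
    by (intro padic_cong_mult T padic_cong_imp_Ints[OF T] padic_Ints_closed)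
  from padic_cong_scale_0[OF True this] show ?thesis
    using True by (simp add: mult.commute numeral_2_eq_2)
next
  case False
  then have T: "padic_cong (dpoly CARD('p) x - dpoly CARD('p) (x - 1)) 0 1"
    using dpoly_CARD_shift_cong_0[of "x - 1"] dpoly_CARD_padic_Ints[of "x - 1"] assms by simp
  have "padic_cong (x * (dpoly CARD('p) x - dpoly CARD('p) (x - 1))\<^sup>2) (x * 0) 2"
    using padic_cong_mult_0[OF T T] assms(2)
    by (intro padic_cong_scale) (simp_all add: power2_eq_square numeral_2_eq_2)
  then show ?thesis
    using False by simp
qed

text \<open>Euler's criterion gives the congruence; both sides are \<open>1\<close> or
  \<open>-1\<close>, and these are distinct modulo \<open>p > 2\<close>.\<close>

lemma Legendre_minus_1:
  assumes "prime p" "odd p"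
  shows "Legendre (-1) (int p) = (-1) ^ ((p - 1) div 2)"
proof -
  have p: "p > 2"
    using assms prime_ge_2_nat[of p] by (cases "p = 2") auto
  then have "[Legendre (-1) (int p) = (-1) ^ ((p - 1) div 2)] (mod int p)"
    using euler_criterion[of p "-1"] assms by simp
  moreover have "Legendre (-1) (int p) \<in> {1, -1}"
    using p by (auto simp: Legendre_def cong_iff_dvd_diff dest: zdvd_imp_le)
  moreover have "(-1) ^ ((p - 1) div 2) \<in> {1, -1 :: int}"
    by (simp add: minus_one_power_iff)
  ultimately show ?thesis
    using p zdvd_not_zless[of 2 "int p"] by (auto simp: cong_iff_dvd_diff)
qed

theorem theorem1p2:
  fixes x :: "'p :: prime_card padic" and p :: nat
  assumes "p = CARD('p)" and "odd p" and "x \<in> padic_Ints"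
  shows
    "(\<Sum>k=0..p-1. (-1) ^ k * (dpoly k x)\<^sup>2) = (\<Sum>k=0..p-1. dpoly k x * dpoly k (-1 - x)) \<and>
     padic_cong (\<Sum>k=0..p-1. dpoly k x * dpoly k (-1 - x)) ((-1) ^ padic_least_residue x) 2 \<and>
     (\<Sum>k=0..p-1. (dpoly k x)\<^sup>2) = (\<Sum>k=0..p-1. (-1) ^ k * dpoly k x * dpoly k (-1 - x)) \<and>
     padic_cong (\<Sum>k=0..p-1. (-1) ^ k * dpoly k x * dpoly k (-1 - x))
       (if padic_cong x (-1/2) 1 then of_int (Legendre (-1) (int p))
        else (-1) ^ padic_least_residue x *
          ((of_nat p + 2 * x - 2 * of_nat (padic_least_residue x)) / (2 * x + 1))) 2 \<and>
     padic_cong (\<Sum>k=0..p-1. of_nat (2 * k + 1) * (dpoly k x)\<^sup>2)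
       (if padic_cong x 0 1 then - x
        else if padic_cong x (-1) 1 then x + 1
        else 0) 2"
proof -
  let ?p = "CARD('p)"
  have odd: "odd ?p" and prime: "prime ?p"
    using assms prime_card by auto
  have "{0..p-1} = {..<p}"
    using odd_pos[OF assms(2)] by auto
  then have range: "{0..p-1} = {..<?p}"
    unfolding assms(1) .
  define r where "r = padic_least_residue x"
  have r: "padic_cong x (of_nat r) 1" "r < ?p"
    unfolding r_def using padic_least_residue[OF assms(3)] by auto
  obtain z where z: "z \<in> padic_Ints" "x = of_nat ?p * z + of_nat r"
    using padic_eq_CARD_mult_plus_residue[OF assms(3)] unfolding r_def by metis
  define F where "F = (\<Sum>k<?p. (-1) ^ k * (dpoly k x)\<^sup>2)"
  define G where "G = (\<Sum>k<?p. (dpoly k x)\<^sup>2)"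
  define H where "H = (\<Sum>k<?p. of_nat (2 * k + 1) * (dpoly k x)\<^sup>2)"
  have F': "(\<Sum>k<?p. dpoly k x * dpoly k (-1 - x)) = F"
    unfolding F_def by (simp add: dpoly_reflect power2_eq_square mult_ac)
  have G': "(\<Sum>k<?p. (-1) ^ k * dpoly k x * dpoly k (-1 - x)) = G"
    unfolding G_def dpoly_reflect
    by (intro sum.cong) (simp_all add: power2_eq_square minus_one_power_iff)
  have F: "padic_cong F ((-1) ^ r) 2"
    unfolding F_def z(2) using odd z(1) r(2) by (rule sum_alternating_dpoly_square_cong)
  have half: "padic_cong x (-1/2) 1 \<longleftrightarrow> padic_cong (2 * x + 1) 0 1"
  proof
    assume "padic_cong x (-1/2) 1"
    from padic_cong_scale[OF _ this, of 2] show "padic_cong (2 * x + 1) 0 1"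
      by (simp add: padic_cong_def)
  next
    assume "padic_cong (2 * x + 1) 0 1"
    then have "padic_cong (2 * x) (2 * (-1/2)) 1"
      by (simp add: padic_cong_def)
    then show "padic_cong x (-1/2) 1"
      by (rule padic_cong_cancel[rotated 2]) (use padic_2_not_cong_0[OF odd] in auto)
  qed
  have G: "padic_cong G
       (if padic_cong x (-1/2) 1 then of_int (Legendre (-1) (int p))
        else (-1) ^ r * ((of_nat p + 2 * x - 2 * of_nat r) / (2 * x + 1))) 2"
  proof (cases "padic_cong x (-1/2) 1")
    case True
    then have x: "padic_cong (2 * x + 1) 0 1"
      by (simp only: half)
    \<comment> \<open>Reflection fixes \<open>x\<close> modulo \<open>p\<close> and negates the
      values of odd index, so these vanish modulo \<open>p\<close>. Their squares vanish modulo
      \<open>p\<^sup>2\<close>, hence the plain and the alternating sum agree.\<close>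
    have odd_term: "padic_cong (dpoly k x) 0 1" if "odd k" "k < ?p" for k
    proof -
      have "padic_cong x (-1 - x) 1"
        using x by (simp add: padic_cong_def algebra_simps)
      then have "padic_cong (dpoly k x) (dpoly k (-1 - x)) 1"
        using that assms(3) by (intro dpoly_padic_cong) auto
      then have "padic_cong (2 * dpoly k x) (2 * 0) 1"
        using \<open>odd k\<close> by (simp add: dpoly_reflect padic_cong_def)
      then show ?thesis
        by (rule padic_cong_cancel[rotated 2]) (use padic_2_not_cong_0[OF odd] in auto)
    qed
    have "padic_cong G F 2"
      unfolding G_def F_def
    proof (rule padic_cong_sum)
      fix k assume k: "k \<in> {..<?p}"
      show "padic_cong ((dpoly k x)\<^sup>2) ((-1) ^ k * (dpoly k x)\<^sup>2) 2"
      proof (cases "even k")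
        case False
        then have sq: "padic_cong ((dpoly k x)\<^sup>2) 0 2"
          using padic_cong_mult_0[OF odd_term odd_term, of k k] k
          by (simp add: power2_eq_square numeral_2_eq_2)
        show ?thesis
          using padic_cong_trans[OF sq padic_cong_sym[OF padic_cong_minus[OF sq, simplified]]] False
          by simp
      qed simp
    qed
    also note F
    \<comment> \<open>The odd number \<open>2 * r + 1\<close> is a positive multiple of
      \<open>p\<close> below \<open>2 * p\<close>, hence equal to \<open>p\<close>.\<close>
    also have "(-1) ^ r = (of_int (Legendre (-1) (int p)) :: 'p padic)"
    proof -
      have "padic_cong (2 * of_nat r + 1) (2 * x + 1 :: 'p padic) 1"
        by (intro padic_cong_add padic_cong_scale padic_cong_sym[OF r(1)]) auto
      then have "padic_cong (of_nat (2 * r + 1) :: 'p padic) 0 1"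
        using padic_cong_trans[OF _ x] by (simp add: add.commute)
      then obtain c where c: "2 * r + 1 = ?p * c"
        unfolding padic_cong_of_nat_0_iff by (elim dvdE)
      have "c < 2"
      proof (rule ccontr)
        assume "\<not> c < 2"
        then have "?p * 2 \<le> 2 * r + 1"
          unfolding c by (intro mult_le_mono2) simp
        then show False
          using r(2) by simp
      qed
      moreover have "c \<noteq> 0"
        using c by (intro notI) simp
      ultimately have "2 * r + 1 = ?p"
        using c by (cases "c = 1") auto
      then have "r = (p - 1) div 2"
        using assms(1) by simp
      then show ?thesis
        using Legendre_minus_1[OF prime odd] assms(1) by simp
    qed
    finally show ?thesis
      using True by simp
  next
    case False
    then have nc: "\<not> padic_cong (2 * x + 1) 0 1"
      by (simp only: half not_False_eq_True)
    then have nz: "2 * x + 1 \<noteq> 0"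
      by auto
    \<comment> \<open>The explicit factor \<open>p\<close> means that \<open>dpoly ?p x\<close> and
      \<open>dpoly (?p - 1) x\<close> matter only modulo \<open>p\<close>.\<close>
    have "(2 * x + 1) * G = of_nat ?p * (dpoly ?p x * dpoly (?p - 1) x)"
      unfolding G_def sum_dpoly_square by (simp only: mult.assoc)
    also have "padic_cong \<dots> (of_nat ?p * ((1 + 2 * z) * (-1) ^ r)) (1 + 1)"
    proof (intro padic_cong_scale_0 padic_cong_mult)
      show "padic_cong (of_nat ?p :: 'p padic) 0 1"
        using padic_cong_CARD_mult[of "1 :: 'p padic"] by simp
      show "padic_cong (dpoly ?p x) (1 + 2 * z) 1"
        unfolding z(2) using odd z(1) r(2) by (rule dpoly_CARD)
      show "padic_cong (dpoly (?p - 1) x) ((-1) ^ r) 1"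
        unfolding z(2) using odd z(1) r(2) by (rule dpoly_CARD_minus_1)
    qed (use odd assms(3) dpoly_CARD_padic_Ints in auto)
    also have "of_nat ?p * ((1 + 2 * z) * (-1) ^ r) =
        (2 * x + 1) * ((-1) ^ r * ((of_nat p + 2 * x - 2 * of_nat r) / (2 * x + 1)))"
    proof -
      \<comment> \<open>This is \<open>p * z = x - r\<close>, which removes \<open>z\<close> from
        the answer.\<close>
      have "of_nat ?p * (1 + 2 * z) = of_nat p + 2 * x - 2 * of_nat r"
        unfolding z(2) assms(1) by (simp add: algebra_simps)
      then show ?thesis
        using nz by (simp add: mult.commute mult.left_commute)
    qed
    finally have "padic_cong G ((-1) ^ r * ((of_nat p + 2 * x - 2 * of_nat r) / (2 * x + 1))) 2"
      unfolding one_add_one by (rule padic_cong_cancel[rotated 2]) (use nc assms(3) in auto)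
    then show ?thesis
      using False by simp
  qed
  have H: "padic_cong H
       (if padic_cong x 0 1 then - x else if padic_cong x (-1) 1 then x + 1 else 0) 2"
    (is "padic_cong _ ?h _")
  proof -
    have iff: "padic_cong x (-1) 1 \<longleftrightarrow> padic_cong (x + 1) 0 1"
      by (simp add: padic_cong_def)
    \<comment> \<open>The two exceptional classes are disjoint because \<open>p\<close> does not
      divide \<open>1\<close>; this reconciles the two separate conditionals with the nested one in
      \<open>?h\<close>.\<close>
    have excl: "\<not> (padic_cong x 0 1 \<and> padic_cong (x + 1) 0 1)"
      using padic_cong_diff[of "x + 1" 0 1 x 0] padic_of_nat_not_cong_0[where 'p = 'p, of 1]
        prime_gt_1_nat[OF prime] by auto
    have "4 * H = (x + 1) * (dpoly ?p (x + 1) - dpoly ?p x)\<^sup>2 - x * (dpoly ?p x - dpoly ?p (x - 1))\<^sup>2"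
      unfolding H_def by (rule sum_odd_weighted_dpoly_square)
    also have "padic_cong \<dots> ((if padic_cong (x + 1) 0 1 then 4 * (x + 1) else 0) -
        (if padic_cong x 0 1 then 4 * x else 0)) 2"
      using dpoly_CARD_backward_square_cong[OF odd, of "x + 1"]
        dpoly_CARD_backward_square_cong[OF odd assms(3)] assms(3)
      by (intro padic_cong_diff) (simp_all only: add_diff_cancel_right' padic_Ints_closed)
    \<comment> \<open>Writing \<open>4\<close> as \<open>2 * 2\<close> lets the unit
      \<open>2\<close> be cancelled twice.\<close>
    also have "(if padic_cong (x + 1) 0 1 then 4 * (x + 1) else 0) -
        (if padic_cong x 0 1 then 4 * x else 0) = 2 * (2 * ?h)"
      unfolding iff using excl by (auto simp: algebra_simps)
    finally have "padic_cong (2 * (2 * H)) (2 * (2 * ?h)) 2"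
      by (simp add: mult.assoc[symmetric])
    then show ?thesis
      using padic_2_not_cong_0[OF odd] padic_Ints_closed(3) by (blast intro: padic_cong_cancel)
  qed
  show ?thesis
    unfolding range F' G' F_def[symmetric] G_def[symmetric] H_def[symmetric] r_def[symmetric]
    by (intro conjI refl F G H)
qed

end
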